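(* For any $\epsilon>0$, achieving a $(3-\epsilon)$-approximation of $\alpha(G)$, with constant probability of success, on an $l_1$ or $l_\infty$ ball stream with $d=2$ and arbitrary dilation $\Delta$ requires $\Omega(n)$ space.
   Context: A $d$-dimensional $l^p$ ball stream is a sequence of $n$ pairs $(x_i,r_i)\in[M]^d\times[M]$ (with $M$ polynomial in $n$), each describing the closed ball $\{y\in\mathbb{R}^d:\|y-x_i\|_p\le r_i\}$; it defines the intersection graph $G$ with one vertex per ball and an edge between two balls iff $\|x_i-x_j\|_p\le r_i+r_j$. The stream is read once. The dilation $\Delta$ is the ratio between the largest and smallest radii in the stream. $\alpha(G)$ is the maximum size of an independent set; a $c$-approximation to $\alpha(G)$ is a value $\gamma$ with $\frac{1}{c}\alpha(G)\le\gamma\le\alpha(G)$. *)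

theory Defs
  imports "HOL-Probability.Probability" "HOL-Library.Landau_Symbols"
begin

text \<open>The \<open>l\<^sup>p\<close> norm on \<open>\<real>\<^sup>d\<close> for \<open>1 \<le> p \<le> \<infinity>\<close>.\<close>

definition lp_norm :: "ereal \<Rightarrow> real ^ 'd::finite \<Rightarrow> real" where
  "lp_norm p x =
     (if p = \<infinity> then infnorm x
      else (\<Sum>i\<in>UNIV. \<bar>x $ i\<bar> powr real_of_ereal p) powr (1 / real_of_ereal p))"

text \<open>A ball is given by its centre and its radius.\<close>

type_synonym 'd ball_desc = "(nat ^ 'd) \<times> nat"

definition ball_streams :: "nat \<Rightarrow> nat \<Rightarrow> ('d::finite) ball_desc list set" where
  "ball_streams M n =
     {bs. length bs = n \<and> (\<forall>(x, r) \<in> set bs. (\<forall>i. x $ i \<in> {1..M}) \<and> r \<in> {1..M})}"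

definition balls_meet :: "ereal \<Rightarrow> ('d::finite) ball_desc \<Rightarrow> 'd ball_desc \<Rightarrow> bool" where
  "balls_meet p b c \<longleftrightarrow>
     lp_norm p ((\<chi> i. real (fst b $ i)) - (\<chi> i. real (fst c $ i))) \<le> real (snd b) + real (snd c)"

text \<open>The vertices of the intersection graph are the positions in the stream, so a ball that
  occurs twice gives two (adjacent) vertices.\<close>

definition intersection_vertices :: "('d::finite) ball_desc list \<Rightarrow> nat set" where
  "intersection_vertices bs = {..<length bs}"

definition intersection_edge :: "ereal \<Rightarrow> ('d::finite) ball_desc list \<Rightarrow> nat \<Rightarrow> nat \<Rightarrow> bool" where
  "intersection_edge p bs i j \<longleftrightarrow> i \<noteq> j \<and> balls_meet p (bs ! i) (bs ! j)"

definition independent_set :: "'v set \<Rightarrow> ('v \<Rightarrow> 'v \<Rightarrow> bool) \<Rightarrow> 'v set \<Rightarrow> bool" where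
  "independent_set V E I \<longleftrightarrow> I \<subseteq> V \<and> (\<forall>u\<in>I. \<forall>v\<in>I. \<not> E u v)"

definition independence_number :: "'v set \<Rightarrow> ('v \<Rightarrow> 'v \<Rightarrow> bool) \<Rightarrow> nat" where
  "independence_number V E = Max (card ` {I. independent_set V E I})"

definition stream_alpha :: "ereal \<Rightarrow> ('d::finite) ball_desc list \<Rightarrow> nat" where
  "stream_alpha p bs = independence_number (intersection_vertices bs) (intersection_edge p bs)"

definition is_approximation :: "real \<Rightarrow> real \<Rightarrow> real \<Rightarrow> bool" where
  "is_approximation c a g \<longleftrightarrow> 1 / c * a \<le> g \<and> g \<le> a"

text \<open>A deterministic one-pass algorithm keeps a bit string in memory and updates it on each
  stream item. Only this string is charged as space: reading the position in the stream
  (the first argument of \<open>update\<close>) is free.\<close>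

record 'a one_pass_alg =
  init_mem :: "bool list"
  update :: "nat \<Rightarrow> bool list \<Rightarrow> 'a \<Rightarrow> bool list"
  answer :: "bool list \<Rightarrow> real"

definition memory_after :: "'a one_pass_alg \<Rightarrow> 'a list \<Rightarrow> bool list" where
  "memory_after D xs = fold (\<lambda>(t, x) m. update D t m x) (List.enumerate 0 xs) (init_mem D)"

text \<open>A randomized algorithm is a probability distribution over deterministic ones. Because
  \<open>update\<close> may depend on the position, this includes algorithms that toss fresh coins at each
  item; the random bits themselves are not charged as space.\<close>

type_synonym 'a rand_alg = "'a one_pass_alg pmf"

definition uses_space :: "'a rand_alg \<Rightarrow> 'a list set \<Rightarrow> nat \<Rightarrow> bool" where
  "uses_space A X s \<longleftrightarrow>
     (\<forall>D \<in> set_pmf A. \<forall>xs \<in> X. \<forall>k \<le> length xs. length (memory_after D (take k xs)) \<le> s)"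

definition approximates_alpha ::
  "ereal \<Rightarrow> real \<Rightarrow> real \<Rightarrow> ('d::finite) ball_desc rand_alg \<Rightarrow> 'd ball_desc list set \<Rightarrow> bool" where
  "approximates_alpha p c \<delta> A X \<longleftrightarrow>
     (\<forall>bs \<in> X. measure_pmf.prob A
        {D. is_approximation c (real (stream_alpha p bs)) (answer D (memory_after D bs))} \<ge> \<delta>)"

end

theory Submission
  imports Defs
begin

text \<open>
  Colour a \<open>K \<times> K\<close> checkerboard. The first player encodes bit \<open>k\<close> of her string by copies of all
  black cells, shifted along the diagonal by an amount depending on \<open>k\<close> and the bit; the second
  player, who knows the shift of one queried copy, encodes her string by copies of the white cells of
  the board with that shift, moved by much smaller amounts along the antidiagonal; the third player
  places tiny squares at the vertices that are the lower left or upper right corner of a black cell,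
  equivalently the upper left or lower right corner of a white one. If both queried copies are
  present, they and the tiny squares are pairwise disjoint, about \<open>3 K\<^sup>2 / 2\<close> squares. If both are absent,
  every other copy has moved over one of its two vertices, so the about \<open>K\<^sup>2 / 2\<close> vertices pierce
  all squares. A \<open>(3 - \<epsilon>)\<close>-approximation thus solves three-player chained index, which needs linear
  space. The \<open>l\<^sub>1\<close> case follows by a rotation.
\<close>

section \<open>Space lower bound for chained index\<close>

lemma exp_add_exp_minus_le:
  fixes x :: real
  assumes "0 \<le> x" "x \<le> 1"
  shows "exp x + exp (- x) \<le> 2 * exp (x\<^sup>2)"
proof -
  \<comment> \<open>The product is \<open>1 + x^3\<close>. It yields a quadratic bound for
    \<open>exp (- x)\<close> whose linear term cancels the one in the bound for
    \<open>exp x\<close>.\<close>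
  have "1 * 1 \<le> (1 - x + x\<^sup>2) * (1 + x)"
    using assms by (simp add: algebra_simps power2_eq_square)
  also have "\<dots> \<le> (1 - x + x\<^sup>2) * exp x"
    using assms by (intro mult_left_mono exp_ge_add_one_self) auto
  finally have "exp (- x) \<le> 1 - x + x\<^sup>2"
    by (simp add: exp_minus field_simps)
  moreover have "exp x \<le> 1 + x + x\<^sup>2" using assms by (rule exp_bound)
  moreover have "1 + x\<^sup>2 \<le> exp (x\<^sup>2)" by (rule exp_ge_add_one_self)
  ultimately show ?thesis by linarith
qed

text \<open>Up to the factor \<open>2 ^ card A\<close> the left side is the moment generating
  function of a weighted sum of independent random signs. It factorises over \<open>A\<close>, and
  each factor is at most \<open>2 * exp (l^2)\<close>.\<close>

lemma sum_Pow_exp_signed_sum_le: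
  fixes g :: "'i \<Rightarrow> real" and l :: real
  assumes "finite A" and g: "\<And>i. 0 \<le> g i \<and> g i \<le> 1" and l: "0 < l" "l \<le> 1"
  shows "(\<Sum>X\<in>Pow A. exp (l * (\<Sum>i\<in>A. (if i \<in> X then 1 else - 1) * g i)))
           \<le> 2 ^ card A * exp (l\<^sup>2 * card A)"
proof -
  have "exp (l * (\<Sum>i\<in>A. (if i \<in> X then 1 else - 1) * g i))
        = (\<Prod>i\<in>X. exp (l * g i)) * (\<Prod>i\<in>A - X. exp (- (l * g i)))" if "X \<subseteq> A" for X
  proof -
    have "(\<Sum>i\<in>A. (if i \<in> X then 1 else - 1) * g i)
        = (\<Sum>i\<in>X. g i) + (\<Sum>i\<in>A - X. - g i)"
      unfolding sum.subset_diff[OF that \<open>finite A\<close>]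
      by (subst add.commute, intro arg_cong2[where f="(+)"] sum.cong) auto
    moreover have "finite X" using that \<open>finite A\<close> finite_subset by blast
    ultimately show ?thesis
      using \<open>finite A\<close> by (simp add: distrib_left exp_add sum_distrib_left exp_sum)
  qed
  then have "(\<Sum>X\<in>Pow A. exp (l * (\<Sum>i\<in>A. (if i \<in> X then 1 else - 1) * g i)))
      = (\<Prod>i\<in>A. exp (l * g i) + exp (- (l * g i)))"
    using \<open>finite A\<close> by (simp add: prod_add)
  also have "\<dots> \<le> (\<Prod>i\<in>A. 2 * exp (l\<^sup>2))"
  proof (intro prod_mono conjI)
    fix i
    have lg: "0 \<le> l * g i" "l * g i \<le> l" using g[of i] l by (auto simp: mult_left_le)
    then have "exp (l * g i) + exp (- (l * g i)) \<le> 2 * exp ((l * g i)\<^sup>2)"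
      using l by (intro exp_add_exp_minus_le) linarith+
    also have "\<dots> \<le> 2 * exp (l\<^sup>2)" using lg by (simp add: abs_le_square_iff[symmetric])
    finally show "exp (l * g i) + exp (- (l * g i)) \<le> 2 * exp (l\<^sup>2)" .
  qed (simp add: add_nonneg_nonneg)
  also have "\<dots> = 2 ^ card A * exp (l\<^sup>2 * card A)"
    by (simp add: power_mult_distrib exp_of_nat2_mult)
  finally show ?thesis .
qed

text \<open>Here \<open>m X\<close> is the message about \<open>X\<close> and \<open>g\<close> the
  probability that a query accepts. The message depends on \<open>X\<close>, so the moment bound for
  fixed weights does not apply directly; summing over all messages removes the dependence at the
  price of \<open>ln (card Ms)\<close>. The inequality \<open>z + 1 \<le> exp z\<close> takes the
  place of Jensen's.\<close>

lemma index_advantage_le: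
  fixes m :: "'i set \<Rightarrow> 'm" and g :: "'m \<Rightarrow> 'i \<Rightarrow> real" and l :: real
  assumes "finite A" "finite Ms" and m: "\<And>X. X \<subseteq> A \<Longrightarrow> m X \<in> Ms"
    and g: "\<And>\<mu> i. 0 \<le> g \<mu> i \<and> g \<mu> i \<le> 1" and l: "0 < l" "l \<le> 1"
  shows "(\<Sum>X\<in>Pow A. \<Sum>i\<in>A. (if i \<in> X then 1 else - 1) * g (m X) i)
           \<le> 2 ^ card A * ((ln (card Ms) + l\<^sup>2 * card A) / l)"
proof -
  define Z where "Z \<mu> X = l * (\<Sum>i\<in>A. (if i \<in> X then 1 else - 1) * g \<mu> i)" for \<mu> X
  \<comment> \<open>With this \<open>c\<close> the factor \<open>exp (- c)\<close> cancels both the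
    number of messages and the moment bound.\<close>
  define c where "c = ln (card Ms) + l\<^sup>2 * card A"
  have Ms: "card Ms > 0" using m[of "{}"] \<open>finite Ms\<close> by (auto simp: card_gt_0_iff)
  have "(\<Sum>X\<in>Pow A. Z (m X) X - c + 1) \<le> (\<Sum>X\<in>Pow A. \<Sum>\<mu>\<in>Ms. exp (Z \<mu> X - c))"
  proof (rule sum_mono)
    fix X assume "X \<in> Pow A"
    have "Z (m X) X - c + 1 \<le> exp (Z (m X) X - c)"
      using exp_ge_add_one_self[of "Z (m X) X - c"] by linarith
    also have "\<dots> \<le> (\<Sum>\<mu>\<in>Ms. exp (Z \<mu> X - c))"
      using \<open>X \<in> Pow A\<close> m \<open>finite Ms\<close> by (intro member_le_sum) auto
    finally show "Z (m X) X - c + 1 \<le> (\<Sum>\<mu>\<in>Ms. exp (Z \<mu> X - c))" .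
  qed
  also have "\<dots> = (\<Sum>\<mu>\<in>Ms. exp (- c) * (\<Sum>X\<in>Pow A. exp (Z \<mu> X)))"
    by (subst sum.swap) (simp add: sum_distrib_left exp_diff exp_minus field_simps)
  also have "\<dots> \<le> (\<Sum>\<mu>\<in>Ms. exp (- c) * (2 ^ card A * exp (l\<^sup>2 * card A)))"
    unfolding Z_def using assms by (intro sum_mono mult_left_mono sum_Pow_exp_signed_sum_le) auto
  also have "\<dots> = 2 ^ card A"
    using Ms by (simp add: c_def exp_add[symmetric]) (simp add: exp_minus)
  finally have "(\<Sum>X\<in>Pow A. Z (m X) X) \<le> 2 ^ card A * c"
    using \<open>finite A\<close> by (simp add: sum.distrib sum_subtractf card_Pow algebra_simps)
  then show ?thesis
    using l by (simp add: Z_def c_def sum_distrib_left[symmetric] field_simps)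
qed

section \<open>Memory contents as messages between the players\<close>

lemma memory_after_append:
  "memory_after D (xs @ ys) =
     fold (\<lambda>(t, x) m. update D t m x) (List.enumerate (length xs) ys) (memory_after D xs)"
  by (simp add: memory_after_def enumerate_append_eq)

lemma card_bool_lists_le: "card {m :: bool list. length m \<le> s} \<le> 2 ^ Suc s"
  and finite_bool_lists_le: "finite {m :: bool list. length m \<le> s}"
proof -
  have "card {m :: bool list. length m \<le> s} = (\<Sum>i\<le>s. 2 ^ i)"
    using card_lists_length_le[of "UNIV :: bool set" s] by simp
  also have "\<dots> < 2 ^ Suc s" by (induction s) auto
  finally show "card {m :: bool list. length m \<le> s} \<le> 2 ^ Suc s" by simp
  show "finite {m :: bool list. length m \<le> s}"
    using finite_lists_length_le[of "UNIV :: bool set" s] by simp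
qed

text \<open>Chained index with three players. With signs \<open>\<sigma>\<close> and \<open>\<tau>\<close> of the two queried bits,
  the event ``both bits set'' minus the event ``both bits clear'' is \<open>(\<sigma> + \<tau>) / 2\<close>, so the advantage
  of the protocol is an average of advantages in two ordinary index problems.\<close>

lemma chained_index_space:
  fixes A :: "'a rand_alg" and P1 :: "nat set \<Rightarrow> 'a list"
    and P2 :: "nat \<Rightarrow> nat set \<Rightarrow> 'a list" and P3 :: "nat \<Rightarrow> nat \<Rightarrow> 'a list" and N :: nat
  defines "B \<equiv> {..<N}"
  assumes N: "N > 0"
    and len1: "\<And>X. length (P1 X) = k1" and len2: "\<And>i Y. length (P2 i Y) = k2"
    and streams: "\<And>X Y i j. X \<subseteq> B \<Longrightarrow> Y \<subseteq> B \<Longrightarrow> i \<in> B \<Longrightarrow> j \<in> B \<Longrightarrow> P1 X @ P2 i Y @ P3 i j \<in> Xs"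
    and space: "uses_space A Xs s"
    and accept: "\<And>X Y i j. X \<subseteq> B \<Longrightarrow> Y \<subseteq> B \<Longrightarrow> i \<in> X \<Longrightarrow> j \<in> Y \<Longrightarrow>
      measure_pmf.prob A {D. out (answer D (memory_after D (P1 X @ P2 i Y @ P3 i j)))} \<ge> \<delta>"
    and reject: "\<And>X Y i j. X \<subseteq> B \<Longrightarrow> Y \<subseteq> B \<Longrightarrow> i \<in> B - X \<Longrightarrow> j \<in> B - Y \<Longrightarrow>
      measure_pmf.prob A {D. \<not> out (answer D (memory_after D (P1 X @ P2 i Y @ P3 i j)))} \<ge> \<delta>"
    and \<delta>: "1 / 2 < \<delta>"
  shows "((2 * \<delta> - 1) / 8)\<^sup>2 * real N \<le> real s + 1"
proof -
  \<comment> \<open>The guaranteed average advantage below is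
    \<open>(2 * \<delta> - 1) / 4 = 2 * l\<close>; half of it as the free parameter leaves
    \<open>l^2 * N \<le> ln (card Ms)\<close> at the end.\<close>
  define l where "l = (2 * \<delta> - 1) / 8"
  have "\<delta> \<le> 1" using accept[of B B 0 0] N measure_pmf.prob_le_1[of A] B_def
    by (metis lessThan_iff order_refl order_trans)
  then have l: "0 < l" "l \<le> 1" using \<delta> by (auto simp: l_def)
  define Ms where "Ms = {m :: bool list. length m \<le> s}"
  define \<eta> where "\<eta> = (ln (card Ms) + l\<^sup>2 * N) / l"
  define \<sigma> :: "nat \<Rightarrow> nat set \<Rightarrow> real" where "\<sigma> i X = (if i \<in> X then 1 else - 1)" for i X
  define g :: "'a one_pass_alg \<Rightarrow> nat set \<Rightarrow> nat set \<Rightarrow> nat \<Rightarrow> nat \<Rightarrow> real" where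
    "g D X Y i j = of_bool (out (answer D (memory_after D (P1 X @ P2 i Y @ P3 i j))))" for D X Y i j
  have [simp]: "finite B" "card B = N" by (simp_all add: B_def)
  have finMs: "finite Ms" unfolding Ms_def by (rule finite_bool_lists_le)
  have mem: "memory_after D (take k (P1 X @ P2 i Y @ P3 i j)) \<in> Ms"
    if "D \<in> set_pmf A" "X \<subseteq> B" "Y \<subseteq> B" "i \<in> B" "j \<in> B"
       "k \<le> length (P1 X @ P2 i Y @ P3 i j)" for D X Y i j k
    using space streams that unfolding uses_space_def Ms_def by blast
  \<comment> \<open>Cut the run after the first player. With \<open>Y\<close> and \<open>j\<close>
    fixed, the rest depends only on the memory and \<open>i\<close>, so it answers index queries to
    \<open>X\<close>.\<close>
  have first: "(\<Sum>X\<in>Pow B. \<Sum>i\<in>B. \<sigma> i X * g D X Y i j) \<le> 2 ^ N * \<eta>"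
    if "D \<in> set_pmf A" "Y \<subseteq> B" "j \<in> B" for D Y j
  proof -
    define G where "G \<mu> i = (of_bool (out (answer D (fold (\<lambda>(t, x) m. update D t m x)
       (List.enumerate k1 (P2 i Y @ P3 i j)) \<mu>))) :: real)" for \<mu> i
    have "memory_after D (P1 X) \<in> Ms" if "X \<subseteq> B" for X
      \<comment> \<open>The query \<open>0\<close> is a dummy: the memory after \<open>k1\<close>
        items does not depend on it.\<close>
      using mem[of D X Y 0 j k1] that N \<open>D \<in> set_pmf A\<close> \<open>Y \<subseteq> B\<close> \<open>j \<in> B\<close> by (simp add: len1 B_def)
    then have "(\<Sum>X\<in>Pow B. \<Sum>i\<in>B. \<sigma> i X * G (memory_after D (P1 X)) i) \<le> 2 ^ N * \<eta>"
      using index_advantage_le[of B Ms "\<lambda>X. memory_after D (P1 X)" G l] finMs l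
      by (simp add: \<sigma>_def \<eta>_def G_def)
    then show ?thesis by (simp add: g_def G_def memory_after_append len1)
  qed
  \<comment> \<open>With \<open>X\<close> and \<open>i\<close> fixed the cut moves behind the second
    player, and the third part answers index queries to \<open>Y\<close>.\<close>
  have second: "(\<Sum>Y\<in>Pow B. \<Sum>j\<in>B. \<sigma> j Y * g D X Y i j) \<le> 2 ^ N * \<eta>"
    if "D \<in> set_pmf A" "X \<subseteq> B" "i \<in> B" for D X i
  proof -
    define G where "G \<mu> j = (of_bool (out (answer D (fold (\<lambda>(t, x) m. update D t m x)
       (List.enumerate (k1 + k2) (P3 i j)) \<mu>))) :: real)" for \<mu> j
    have "memory_after D (P1 X @ P2 i Y) \<in> Ms" if "Y \<subseteq> B" for Y
      using mem[of D X Y i 0 "k1 + k2"] that N \<open>D \<in> set_pmf A\<close> \<open>X \<subseteq> B\<close> \<open>i \<in> B\<close>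
      by (simp add: len1 len2 B_def)
    then have "(\<Sum>Y\<in>Pow B. \<Sum>j\<in>B. \<sigma> j Y * G (memory_after D (P1 X @ P2 i Y)) j) \<le> 2 ^ N * \<eta>"
      using index_advantage_le[of B Ms "\<lambda>Y. memory_after D (P1 X @ P2 i Y)" G l] finMs l
      by (simp add: \<sigma>_def \<eta>_def G_def)
    moreover have "g D X Y i j = G (memory_after D (P1 X @ P2 i Y)) j" for Y j
      unfolding g_def G_def append_assoc[symmetric]
      by (subst memory_after_append) (simp add: len1 len2)
    ultimately show ?thesis by simp
  qed
  define I where "I = B \<times> B \<times> Pow B \<times> Pow B"
  have cardI: "real (card I) = (2 ^ N)\<^sup>2 * (real N)\<^sup>2"
    by (simp add: I_def card_cartesian_product card_Pow power2_eq_square)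
  define adv where "adv D = (\<Sum>(i, j, X, Y)\<in>I. (\<sigma> i X + \<sigma> j Y) / 2 * g D X Y i j)" for D
  have adv_le: "adv D \<le> (2 ^ N)\<^sup>2 * N * \<eta>" if D: "D \<in> set_pmf A" for D
  proof -
    have "2 * adv D = (\<Sum>(i, j, X, Y)\<in>I. \<sigma> i X * g D X Y i j)
        + (\<Sum>(i, j, X, Y)\<in>I. \<sigma> j Y * g D X Y i j)"
      unfolding adv_def sum_distrib_left sum.distrib[symmetric]
      by (intro sum.cong) (auto simp: algebra_simps)
    also have "(\<Sum>(i, j, X, Y)\<in>I. \<sigma> i X * g D X Y i j)
        = (\<Sum>j\<in>B. \<Sum>Y\<in>Pow B. \<Sum>X\<in>Pow B. \<Sum>i\<in>B. \<sigma> i X * g D X Y i j)"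
      unfolding I_def sum.cartesian_product
      by (rule sum.reindex_bij_witness[of _ "\<lambda>(j, Y, X, i). (i, j, X, Y)" "\<lambda>(i, j, X, Y). (j, Y, X, i)"])
        auto
    also have "\<dots> \<le> (\<Sum>j\<in>B. \<Sum>Y\<in>Pow B. 2 ^ N * \<eta>)"
      using first D by (intro sum_mono) auto
    also have "(\<Sum>(i, j, X, Y)\<in>I. \<sigma> j Y * g D X Y i j)
        = (\<Sum>i\<in>B. \<Sum>X\<in>Pow B. \<Sum>Y\<in>Pow B. \<Sum>j\<in>B. \<sigma> j Y * g D X Y i j)"
      unfolding I_def sum.cartesian_product
      by (rule sum.reindex_bij_witness[of _ "\<lambda>(i, X, Y, j). (i, j, X, Y)" "\<lambda>(i, j, X, Y). (i, X, Y, j)"])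
        auto
    also have "\<dots> \<le> (\<Sum>i\<in>B. \<Sum>X\<in>Pow B. 2 ^ N * \<eta>)"
      using second D by (intro sum_mono) auto
    finally show ?thesis by (simp add: card_Pow power2_eq_square algebra_simps)
  qed
  have int_g: "integrable (measure_pmf A) (\<lambda>D. g D X Y i j)" for X Y i j
    by (rule measure_pmf.integrable_const_bound[where B=1]) (auto simp: g_def)
  have "integrable (measure_pmf A) adv"
    unfolding adv_def case_prod_unfold by (intro Bochner_Integration.integrable_sum integrable_mult_right int_g)
  then have "measure_pmf.expectation A adv \<le> (2 ^ N)\<^sup>2 * N * \<eta>"
    using adv_le by (intro measure_pmf.integral_le_const) (auto simp: AE_measure_pmf_iff)
  moreover have "measure_pmf.expectation A adv =
     (\<Sum>(i, j, X, Y)\<in>I. (\<sigma> i X + \<sigma> j Y) / 2 * measure_pmf.expectation A (\<lambda>D. g D X Y i j))"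
    unfolding adv_def case_prod_unfold
    by (subst Bochner_Integration.integral_sum) (auto intro!: integrable_mult_right int_g)
  \<comment> \<open>The products of signs on the left are the indicators of both bits set and both
    bits clear. Acceptance has probability at least \<delta> in the first case and at most
    \<open>1 - \<delta>\<close> in the second; if the bits differ, both sides vanish.\<close>
  moreover have "(\<Sum>(i, j, X, Y)\<in>I. (1 + \<sigma> i X) * (1 + \<sigma> j Y) / 4 * \<delta> - (1 - \<sigma> i X) * (1 - \<sigma> j Y) / 4 * (1 - \<delta>))
     \<le> (\<Sum>(i, j, X, Y)\<in>I. (\<sigma> i X + \<sigma> j Y) / 2 * measure_pmf.expectation A (\<lambda>D. g D X Y i j))"
  proof (rule sum_mono, clarify)
    fix i j X Y assume "(i, j, X, Y) \<in> I"
    then have XY: "X \<subseteq> B" "Y \<subseteq> B" "i \<in> B" "j \<in> B" by (auto simp: I_def)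
    define E where "E = {D. out (answer D (memory_after D (P1 X @ P2 i Y @ P3 i j)))}"
    have Eg: "measure_pmf.expectation A (\<lambda>D. g D X Y i j) = measure_pmf.prob A E"
    proof -
      have "(\<lambda>D. g D X Y i j) = indicat_real E" by (auto simp: g_def E_def indicator_def)
      then show ?thesis by simp
    qed
    have "measure_pmf.prob A (- E) = 1 - measure_pmf.prob A E"
      by (simp add: measure_pmf.prob_compl[of E A, symmetric] Compl_eq_Diff_UNIV)
    moreover have "i \<in> X \<Longrightarrow> j \<in> Y \<Longrightarrow> measure_pmf.prob A E \<ge> \<delta>"
      using accept[of X Y i j] XY by (auto simp: E_def)
    moreover have "i \<notin> X \<Longrightarrow> j \<notin> Y \<Longrightarrow> measure_pmf.prob A (- E) \<ge> \<delta>"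
      using reject[of X Y i j] XY by (auto simp: E_def Collect_neg_eq)
    ultimately show "(1 + \<sigma> i X) * (1 + \<sigma> j Y) / 4 * \<delta> - (1 - \<sigma> i X) * (1 - \<sigma> j Y) / 4 * (1 - \<delta>)
      \<le> (\<sigma> i X + \<sigma> j Y) / 2 * measure_pmf.expectation A (\<lambda>D. g D X Y i j)"
      unfolding Eg by (auto simp: \<sigma>_def)
  qed
  moreover have "(\<Sum>(i, j, X, Y)\<in>I. (1 + \<sigma> i X) * (1 + \<sigma> j Y) / 4 * \<delta> - (1 - \<sigma> i X) * (1 - \<sigma> j Y) / 4 * (1 - \<delta>))
     = card I * ((2 * \<delta> - 1) / 4)"
  proof -
    \<comment> \<open>Toggling membership of \<open>i\<close> is a sign-reversing
      involution.\<close>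
    have sig: "(\<Sum>X\<in>Pow B. \<sigma> i X) = 0" if "i \<in> B" for i
    proof -
      have "(\<Sum>X\<in>Pow B. \<sigma> i X) = (\<Sum>X\<in>Pow B. - \<sigma> i X)"
        by (rule sum.reindex_bij_witness[of _ "\<lambda>X. if i \<in> X then X - {i} else insert i X"
              "\<lambda>X. if i \<in> X then X - {i} else insert i X"]) (use that in \<open>auto simp: \<sigma>_def\<close>)
      then show ?thesis by (simp add: sum_negf)
    qed
    have pair: "(\<Sum>X\<in>Pow B. \<Sum>Y\<in>Pow B. (1 + \<sigma> i X) * (1 + \<sigma> j Y) / 4 * \<delta>
            - (1 - \<sigma> i X) * (1 - \<sigma> j Y) / 4 * (1 - \<delta>)) = (2 ^ N)\<^sup>2 * ((2 * \<delta> - 1) / 4)"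
      if "i \<in> B" "j \<in> B" for i j
    proof -
      have "(\<Sum>X\<in>Pow B. \<Sum>Y\<in>Pow B. (1 + \<sigma> i X) * (1 + \<sigma> j Y) / 4 * \<delta>
            - (1 - \<sigma> i X) * (1 - \<sigma> j Y) / 4 * (1 - \<delta>))
        = (\<Sum>X\<in>Pow B. 1 + \<sigma> i X) * (\<Sum>Y\<in>Pow B. 1 + \<sigma> j Y) / 4 * \<delta>
          - (\<Sum>X\<in>Pow B. 1 - \<sigma> i X) * (\<Sum>Y\<in>Pow B. 1 - \<sigma> j Y) / 4 * (1 - \<delta>)"
        by (subst sum_product)+ (simp only: sum_divide_distrib sum_distrib_right sum_subtractf)
      also have "\<dots> = (2 ^ N)\<^sup>2 * ((2 * \<delta> - 1) / 4)"
        using that by (simp add: sum.distrib sum_subtractf sig card_Pow power2_eq_square field_simps)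
      finally show ?thesis .
    qed
    have "(\<Sum>(i, j, X, Y)\<in>I. (1 + \<sigma> i X) * (1 + \<sigma> j Y) / 4 * \<delta> - (1 - \<sigma> i X) * (1 - \<sigma> j Y) / 4 * (1 - \<delta>))
        = (\<Sum>i\<in>B. \<Sum>j\<in>B. (2 ^ N)\<^sup>2 * ((2 * \<delta> - 1) / 4))"
      unfolding I_def sum.cartesian_product[symmetric] by (intro sum.cong refl pair)
    then show ?thesis
      by (simp add: cardI power2_eq_square)
  qed
  ultimately have "card I * (2 * l) \<le> (2 ^ N)\<^sup>2 * N * \<eta>" unfolding l_def by linarith
  then have "N * (2 * l) \<le> \<eta>"
    using N unfolding cardI by (simp add: power2_eq_square)
  then have "l\<^sup>2 * N \<le> ln (card Ms)"
    using l by (simp add: \<eta>_def field_simps power2_eq_square)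
  also have "\<dots> \<le> ln (2 ^ Suc s)"
  proof -
    have "[] \<in> Ms" by (simp add: Ms_def)
    then have "card Ms > 0" using finMs card_gt_0_iff by blast
    moreover have "real (card Ms) \<le> 2 ^ Suc s"
      using card_bool_lists_le[of s] unfolding Ms_def by (metis of_nat_le_iff of_nat_numeral of_nat_power)
    ultimately show ?thesis by (intro ln_mono) auto
  qed
  also have "\<dots> = (real s + 1) * ln 2" by (simp add: ln_realpow ln_mult algebra_simps)
  also have "\<dots> \<le> (real s + 1) * 1" using ln_2_less_1 by (intro mult_left_mono) auto
  finally show ?thesis by (simp add: l_def)
qed

section \<open>Streams of squares\<close>

lemma card_le_stream_alpha:
  assumes "finite J" and "\<And>j. j \<in> J \<Longrightarrow> b j \<in> set bs"
    and "\<And>j. j \<in> J \<Longrightarrow> balls_meet p (b j) (b j)"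
    and disj: "\<And>j k. j \<in> J \<Longrightarrow> k \<in> J \<Longrightarrow> j \<noteq> k \<Longrightarrow> \<not> balls_meet p (b j) (b k)"
  shows "card J \<le> stream_alpha p bs"
proof -
  obtain f where f: "\<And>j. j \<in> J \<Longrightarrow> f j < length bs \<and> bs ! f j = b j"
    using assms(2) unfolding in_set_conv_nth by metis
  \<comment> \<open>Two indices at one position would share a ball; it meets itself, against
    \<open>disj\<close>.\<close>
  have "inj_on f J"
    by (rule inj_onI) (metis assms(3) disj f)
  moreover have "independent_set (intersection_vertices bs) (intersection_edge p bs) (f ` J)"
    using f disj by (fastforce simp: independent_set_def intersection_vertices_def intersection_edge_def)
  moreover have "finite {I. independent_set (intersection_vertices bs) (intersection_edge p bs) I}"
    by (rule finite_subset[of _ "Pow {..<length bs}"])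
       (auto simp: independent_set_def intersection_vertices_def)
  ultimately show ?thesis
    unfolding stream_alpha_def independence_number_def
    by (intro Max_ge) (auto simp: card_image intro!: image_eqI[of _ _ "f ` J"])
qed

text \<open>The relation \<open>R\<close> covers the vertices by cliques, one for each element of
  \<open>V\<close>, and an independent set has at most one vertex in each clique.\<close>

lemma stream_alpha_le_card:
  assumes "finite V" and cover: "\<And>b. b \<in> set bs \<Longrightarrow> \<exists>w\<in>V. R b w"
    and clique: "\<And>b c w. b \<in> set bs \<Longrightarrow> c \<in> set bs \<Longrightarrow> R b w \<Longrightarrow> R c w \<Longrightarrow> balls_meet p b c"
  shows "stream_alpha p bs \<le> card V"
proof -
  have "card I \<le> card V"
    if I: "independent_set (intersection_vertices bs) (intersection_edge p bs) I" for I
  proof -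
    have I_len: "i < length bs" if "i \<in> I" for i
      using I that by (auto simp: independent_set_def intersection_vertices_def)
    have "\<forall>i\<in>I. \<exists>w. w \<in> V \<and> R (bs ! i) w"
      using cover I_len by (meson nth_mem)
    then obtain f where f: "\<And>i. i \<in> I \<Longrightarrow> f i \<in> V \<and> R (bs ! i) (f i)"
      by metis
    have "inj_on f I"
    proof (rule inj_onI, rule ccontr)
      fix i j assume ij: "i \<in> I" "j \<in> I" "f i = f j" "i \<noteq> j"
      then have "balls_meet p (bs ! i) (bs ! j)"
        using clique f I_len nth_mem by metis
      then show False
        using I ij by (auto simp: independent_set_def intersection_edge_def)
    qed
    then show ?thesis using f \<open>finite V\<close> by (auto intro: card_inj_on_le)
  qed
  moreover have "finite {I. independent_set (intersection_vertices bs) (intersection_edge p bs) I}"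
    by (rule finite_subset[of _ "Pow {..<length bs}"])
       (auto simp: independent_set_def intersection_vertices_def)
  moreover have "independent_set (intersection_vertices bs) (intersection_edge p bs) {}"
    by (simp add: independent_set_def)
  ultimately show ?thesis
    unfolding stream_alpha_def independence_number_def by (subst Max_le_iff) auto
qed

section \<open>Axis-parallel squares, given by centre and half side, as balls in both norms\<close>

type_synonym square = "int \<times> int \<times> int"

fun squares_meet :: "square \<Rightarrow> square \<Rightarrow> bool" where
  "squares_meet (x, y, r) (x', y', r') \<longleftrightarrow> \<bar>x - x'\<bar> \<le> r + r' \<and> \<bar>y - y'\<bar> \<le> r + r'"

fun in_square :: "int \<times> int \<Rightarrow> square \<Rightarrow> bool" where
  "in_square (a, b) (x, y, r) \<longleftrightarrow> \<bar>x - a\<bar> \<le> r \<and> \<bar>y - b\<bar> \<le> r"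

fun valid_square :: "int \<Rightarrow> square \<Rightarrow> bool" where
  "valid_square C (x, y, r) \<longleftrightarrow> 1 \<le> x \<and> x \<le> C \<and> 1 \<le> y \<and> y \<le> C \<and> 1 \<le> r \<and> r \<le> C"

lemma squares_meet_if_common_point:
  "in_square z b \<Longrightarrow> in_square z c \<Longrightarrow> squares_meet b c"
  by (cases z; cases b; cases c) auto

text \<open>The map \<open>(x, y) \<mapsto> (x + y, x - y)\<close> doubles distances from \<open>l\<^sub>\<infinity>\<close> to \<open>l\<^sub>1\<close>.\<close>

fun square_ball :: "ereal \<Rightarrow> int \<Rightarrow> square \<Rightarrow> 2 ball_desc" where
  "square_ball p C (x, y, r) =
     (if p = \<infinity> then ((\<chi> i. if i = 1 then nat x else nat y), nat r)
      else ((\<chi> i. if i = 1 then nat (x + y) else nat (x - y + C)), nat (2 * r)))"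

text \<open>For \<open>p = 1\<close> this is the identity
  \<open>|s + t| + |s - t| = 2 * max |s| |t|\<close> for the coordinate differences of the centres;
  the offset \<open>C\<close> cancels.\<close>

lemma balls_meet_square_ball:
  assumes p: "p \<in> {1, \<infinity>}" and "valid_square C b" "valid_square C c"
  shows "balls_meet p (square_ball p C b) (square_ball p C c) \<longleftrightarrow> squares_meet b c"
proof -
  obtain x y r where b: "b = (x, y, r)" by (cases b)
  obtain x' y' r' where c: "c = (x', y', r')" by (cases c)
  show ?thesis
  proof (cases "p = \<infinity>")
    case True
    then have "balls_meet p (square_ball p C b) (square_ball p C c) \<longleftrightarrow>
        max \<bar>real_of_int x - x'\<bar> \<bar>real_of_int y - y'\<bar> \<le> real_of_int r + r'"
      using assms by (simp add: balls_meet_def lp_norm_def infnorm_2 b c)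
    also have "\<dots> \<longleftrightarrow> squares_meet b c" unfolding b c by simp linarith
    finally show ?thesis .
  next
    case False
    then have "p = 1" using p by auto
    then have "balls_meet p (square_ball p C b) (square_ball p C c) \<longleftrightarrow>
        \<bar>(real_of_int x + y) - (x' + y')\<bar> + \<bar>(real_of_int x - y + C) - (x' - y' + C)\<bar>
          \<le> 2 * real_of_int r + 2 * r'"
      using assms by (simp add: balls_meet_def lp_norm_def sum_2 b c)
    also have "\<dots> \<longleftrightarrow> squares_meet b c" unfolding b c by simp linarith
    finally show ?thesis .
  qed
qed

text \<open>For \<open>p = 1\<close> the offset \<open>C\<close> keeps \<open>x - y + C\<close>
  positive, and coordinates and radius may reach \<open>2 * C\<close>, whence the factor 2.\<close>

lemma square_balls_in_ball_streams:
  assumes "p \<in> {1, \<infinity>}" "\<And>b. b \<in> set bs \<Longrightarrow> valid_square C b" "2 * C \<le> int M" "length bs = n"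
  shows "map (square_ball p C) bs \<in> ball_streams M n"
proof -
  have "(\<forall>i. fst (square_ball p C b) $ i \<in> {1..M}) \<and> snd (square_ball p C b) \<in> {1..M}"
    if "b \<in> set bs" for b
    using assms(2)[OF that] assms(1,3) by (cases b) auto
  then show ?thesis
    unfolding ball_streams_def using assms(4) by (simp add: case_prod_beta)
qed

lemma valid_square_meets_self: "valid_square C b \<Longrightarrow> squares_meet b b"
  by (cases b) auto

lemma card_le_stream_alpha_squares:
  assumes p: "p \<in> {1, \<infinity>}" and valid: "\<And>c. c \<in> set cs \<Longrightarrow> valid_square C c"
    and "finite J" and mem: "\<And>j. j \<in> J \<Longrightarrow> b j \<in> set cs"
    and disj: "\<And>j k. j \<in> J \<Longrightarrow> k \<in> J \<Longrightarrow> j \<noteq> k \<Longrightarrow> \<not> squares_meet (b j) (b k)"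
  shows "card J \<le> stream_alpha p (map (square_ball p C) cs)"
  using assms
  by (intro card_le_stream_alpha[where b = "\<lambda>j. square_ball p C (b j)"])
     (auto simp: balls_meet_square_ball valid_square_meets_self[of C])

lemma stream_alpha_squares_le_card:
  assumes p: "p \<in> {1, \<infinity>}" and valid: "\<And>c. c \<in> set cs \<Longrightarrow> valid_square C c"
    and "finite V" and pierced: "\<And>c. c \<in> set cs \<Longrightarrow> \<exists>w\<in>V. in_square (z w) c"
  shows "stream_alpha p (map (square_ball p C) cs) \<le> card V"
proof (rule stream_alpha_le_card[where R = "\<lambda>b w. \<exists>c\<in>set cs. b = square_ball p C c \<and> in_square (z w) c"])
  show "\<exists>w\<in>V. \<exists>c\<in>set cs. b = square_ball p C c \<and> in_square (z w) c"
    if "b \<in> set (map (square_ball p C) cs)" for b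
    using that pierced unfolding set_map by blast
  fix b b' w
  assume "\<exists>c\<in>set cs. b = square_ball p C c \<and> in_square (z w) c"
    and "\<exists>c\<in>set cs. b' = square_ball p C c \<and> in_square (z w) c"
  then show "balls_meet p b b'"
    using balls_meet_square_ball[OF p valid valid] squares_meet_if_common_point by blast
qed fact

section \<open>The checkerboard\<close>

text \<open>The cell side \<open>2 * half_side T = 4 * (T + 1)^2\<close> equals \<open>T + 1\<close>
  diagonal steps of \<open>4 * (T + 1)\<close>, so even the largest shift \<open>T\<close> stops one
  step short of a full cell.\<close>

definition half_side :: "int \<Rightarrow> int" where
  "half_side T = 2 * (T + 1)\<^sup>2"

text \<open>Shifts range over \<open>{0..T}\<close>. Cell \<open>(a, b)\<close> has lower left vertex \<open>(a, b)\<close> and side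
  \<open>2 * half_side T\<close>; it is black if \<open>a + b\<close> is even. A diagonal step of \<open>4 * (T + 1)\<close> outweighs both the
  margin \<open>2 * (T + 1)\<close> by which black squares are shrunk and all antidiagonal shifts \<open>2 * v\<close>.\<close>

definition grid_line :: "int \<Rightarrow> int \<Rightarrow> nat \<Rightarrow> int" where
  "grid_line T u k = half_side T * (2 * int k + 1) + 4 * (T + 1) * u"

fun black_square :: "int \<Rightarrow> int \<Rightarrow> nat \<times> nat \<Rightarrow> square" where
  "black_square T u (a, b) =
     (grid_line T u a + half_side T, grid_line T u b + half_side T, half_side T - 2 * T - 2)"

text \<open>The margin 2 makes room for query squares of half side 1 at the corners, yet it does not
  exceed the distance 2 between consecutive antidiagonal shifts.\<close>

fun white_square :: "int \<Rightarrow> int \<Rightarrow> int \<Rightarrow> nat \<times> nat \<Rightarrow> square" where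
  "white_square T u v (a, b) =
     (grid_line T u a + half_side T + 2 * v, grid_line T u b + half_side T - 2 * v, half_side T - 2)"

fun query_point :: "int \<Rightarrow> int \<Rightarrow> int \<Rightarrow> nat \<times> nat \<Rightarrow> int \<times> int" where
  "query_point T u v (a, b) = (grid_line T u a + 2 * v, grid_line T u b - 2 * v)"

fun query_square :: "int \<Rightarrow> int \<Rightarrow> int \<Rightarrow> nat \<times> nat \<Rightarrow> square" where
  "query_square T u v (a, b) = (grid_line T u a + 2 * v, grid_line T u b - 2 * v, 1)"

definition query_vertices :: "nat \<Rightarrow> (nat \<times> nat) set" where
  "query_vertices K = {(a, b). a \<le> K \<and> b \<le> K \<and> even (a + b)}"

lemma finite_query_vertices: "finite (query_vertices K)"
  by (rule finite_subset[of _ "{..K} \<times> {..K}"]) (auto simp: query_vertices_def)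

text \<open>For a given \<open>a\<close> the parity of \<open>b\<close> is known, so
  \<open>b div 2\<close> determines \<open>b\<close>.\<close>

lemma card_query_vertices_le: "2 * card (query_vertices K) \<le> (K + 1) * (K + 2)"
proof -
  have "inj_on (\<lambda>(a, b). (a, b div 2)) (query_vertices K)"
    by (rule inj_onI) (auto simp: query_vertices_def; presburger)
  then have "card (query_vertices K) \<le> card ({..K} \<times> {..K div 2})"
    by (rule card_inj_on_le) (auto simp: query_vertices_def)
  also have "\<dots> = (K + 1) * (K div 2 + 1)" by (simp add: card_cartesian_product)
  finally have "2 * card (query_vertices K) \<le> (K + 1) * (2 * (K div 2) + 2)" by simp
  also have "\<dots> \<le> (K + 1) * (K + 2)" by (intro mult_left_mono) auto
  finally show ?thesis .
qed

lemma half_side_ge: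
  assumes "1 \<le> T"
  shows "half_side T \<ge> 4 * T + 4"
proof -
  have "2 * ((T + 1) * 2) \<le> 2 * ((T + 1) * (T + 1))" using assms by (intro mult_left_mono) auto
  then show ?thesis by (simp add: half_side_def power2_eq_square)
qed

lemma grid_line_Suc: "grid_line T u (Suc k) = grid_line T u k + 2 * half_side T"
  by (simp add: grid_line_def algebra_simps)

lemma grid_line_less:
  assumes "k < k'"
  shows "grid_line T u k + 2 * half_side T \<le> grid_line T u k'"
proof -
  have "half_side T * (2 * int k + 3) \<le> half_side T * (2 * int k' + 1)"
    using assms by (intro mult_left_mono) (auto simp: half_side_def)
  then show ?thesis by (simp add: grid_line_def algebra_simps)
qed

lemma grid_line_shift_bounds:
  assumes "0 \<le> u" "u < u'" "u' \<le> T"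
  shows "grid_line T u k + 4 * T + 4 \<le> grid_line T u' k"
    and "grid_line T u' k \<le> grid_line T u k + 2 * half_side T - 4 * T - 4"
proof -
  have "4 * (T + 1) * 1 \<le> 4 * (T + 1) * (u' - u)" using assms by (intro mult_left_mono) auto
  then show "grid_line T u k + 4 * T + 4 \<le> grid_line T u' k"
    by (simp add: grid_line_def algebra_simps)
  have "4 * (T + 1) * (u' - u) \<le> 4 * (T + 1) * T" using assms by (intro mult_left_mono) auto
  then show "grid_line T u' k \<le> grid_line T u k + 2 * half_side T - 4 * T - 4"
    by (simp add: grid_line_def half_side_def power2_eq_square algebra_simps)
qed

lemma grid_line_bounds:
  assumes "0 \<le> u" "u \<le> T" "k \<le> K"
  shows "half_side T \<le> grid_line T u k"
    and "grid_line T u k \<le> half_side T * (2 * int K + 3) - 4 * T - 4"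
proof -
  have "0 \<le> half_side T * (2 * int k)" "0 \<le> 4 * (T + 1) * u"
    using assms by (auto simp: half_side_def)
  then show "half_side T \<le> grid_line T u k"
    by (simp add: grid_line_def distrib_left)
  have "half_side T * (2 * int k) \<le> half_side T * (2 * int K)"
    using assms by (intro mult_left_mono) (auto simp: half_side_def)
  moreover have "4 * (T + 1) * u \<le> 4 * (T + 1) * T" using assms by (intro mult_left_mono) auto
  moreover have "4 * (T + 1) * T = 2 * half_side T - 4 * T - 4"
    by (simp add: half_side_def power2_eq_square algebra_simps)
  ultimately show "grid_line T u k \<le> half_side T * (2 * int K + 3) - 4 * T - 4"
    unfolding grid_line_def distrib_left by linarith
qed

section \<open>Disjointness of the squares at the queried shifts\<close>

lemma squares_meet_commute: "squares_meet b c \<longleftrightarrow> squares_meet c b"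
  by (cases b; cases c) (auto simp: abs_minus_commute add.commute)

text \<open>Distinct cells are a full cell side apart in some coordinate; for equally shifted
  squares of one kind this exceeds the sum of the half sides.\<close>

lemma distinct_cells_cases:
  fixes a b a' b' :: nat
  assumes "(a, b) \<noteq> (a', b')"
  obtains "grid_line T u a + 2 * half_side T \<le> grid_line T u a'"
    | "grid_line T u a' + 2 * half_side T \<le> grid_line T u a"
    | "grid_line T u b + 2 * half_side T \<le> grid_line T u b'"
    | "grid_line T u b' + 2 * half_side T \<le> grid_line T u b"
  using assms grid_line_less by (metis nat_neq_iff)

lemma black_black_disjoint:
  assumes "1 \<le> T" "c \<noteq> c'"
  shows "\<not> squares_meet (black_square T u c) (black_square T u c')"
proof -
  obtain a b a' b' where c: "c = (a, b)" "c' = (a', b')" by (cases c; cases c')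
  then have "(a, b) \<noteq> (a', b')" using assms by simp
  then show ?thesis
    unfolding c squares_meet.simps black_square.simps
    by (rule distinct_cells_cases[of a b a' b' T u]; insert half_side_ge[OF \<open>1 \<le> T\<close>] assms;
        intro notI; elim conjE; linarith)
qed

lemma white_white_disjoint:
  assumes "1 \<le> T" "c \<noteq> c'"
  shows "\<not> squares_meet (white_square T u v c) (white_square T u v c')"
proof -
  obtain a b a' b' where c: "c = (a, b)" "c' = (a', b')" by (cases c; cases c')
  then have "(a, b) \<noteq> (a', b')" using assms by simp
  then show ?thesis
    unfolding c squares_meet.simps white_square.simps
    by (rule distinct_cells_cases[of a b a' b' T u]; insert half_side_ge[OF \<open>1 \<le> T\<close>] assms;
        intro notI; elim conjE; linarith)
qed

lemma query_query_disjoint: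
  assumes "1 \<le> T" "c \<noteq> c'"
  shows "\<not> squares_meet (query_square T u v c) (query_square T u v c')"
proof -
  obtain a b a' b' where c: "c = (a, b)" "c' = (a', b')" by (cases c; cases c')
  then have "(a, b) \<noteq> (a', b')" using assms by simp
  then show ?thesis
    unfolding c squares_meet.simps query_square.simps
    by (rule distinct_cells_cases[of a b a' b' T u]; insert half_side_ge[OF \<open>1 \<le> T\<close>] assms;
        intro notI; elim conjE; linarith)
qed

text \<open>The antidiagonal shift brings the centres closer by at most \<open>2 * T\<close>, while
  the black margin alone is \<open>2 * T + 2\<close>.\<close>

lemma black_white_disjoint:
  assumes "1 \<le> T" "0 \<le> v" "v \<le> T" "c \<noteq> c'"
  shows "\<not> squares_meet (black_square T u c) (white_square T u v c')"
proof -
  obtain a b a' b' where c: "c = (a, b)" "c' = (a', b')" by (cases c; cases c')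
  then have "(a, b) \<noteq> (a', b')" using assms by simp
  then show ?thesis
    unfolding c squares_meet.simps black_square.simps white_square.simps
    by (rule distinct_cells_cases[of a b a' b' T u]; insert half_side_ge[OF \<open>1 \<le> T\<close>] assms;
        intro notI; elim conjE; linarith)
qed

text \<open>Both squares carry the same shift. No vertex lies strictly inside a column of cells, so
  the first coordinates differ by at least \<open>half_side T\<close>, and the half sides add up to
  one less.\<close>

lemma white_query_disjoint:
  assumes "1 \<le> T"
  shows "\<not> squares_meet (white_square T u v c) (query_square T u v w)"
proof -
  obtain a b a' b' where c: "c = (a, b)" "w = (a', b')" by (cases c; cases w)
  have "grid_line T u a + 2 * half_side T \<le> grid_line T u a' \<or> grid_line T u a' \<le> grid_line T u a"
    using grid_line_less[of a a' T u] grid_line_less[of a' a T u] half_side_ge[OF \<open>1 \<le> T\<close>] assms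
    by (cases a a' rule: linorder_cases) auto
  then show ?thesis
    using half_side_ge[OF \<open>1 \<le> T\<close>] assms by (auto simp: c)
qed

text \<open>The shift moves query vertices right and down. A vertex on or right of the right line of
  the cell, or on or below its lower line, moves away. One left of the left line, or above the upper
  line, is at least a cell side off it, too far for the shift. The upper left corner remains, and
  parity excludes it.\<close>

lemma black_query_disjoint:
  assumes "1 \<le> T" "0 \<le> v" "v \<le> T" "even (fst c + snd c)" "even (fst w + snd w)"
  shows "\<not> squares_meet (black_square T u c) (query_square T u v w)"
proof -
  obtain a b a' b' where c: "c = (a, b)" "w = (a', b')" by (cases c; cases w)
  \<comment> \<open>The cell to the lower right of a query vertex is white.\<close>
  have "\<not> (a = a' \<and> b' = Suc b)" using assms by (auto simp: c)
  then consider "a < a'" | "b' = b" | "b' < b" | "a' < a" | "Suc b < b'"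
    by linarith
  then show ?thesis
    using grid_line_less[of a a' T u] grid_line_less[of b' b T u] grid_line_less[of a' a T u]
      grid_line_less[of "Suc b" b' T u] half_side_ge[OF \<open>1 \<le> T\<close>] assms(1-3)
    by cases (auto simp: c grid_line_Suc)
qed

section \<open>Piercing of the copies at other shifts\<close>

lemma black_pierced:
  assumes "u \<noteq> u'" "0 \<le> u" "u \<le> T" "0 \<le> u'" "u' \<le> T" "0 \<le> v" "v \<le> T"
    and c: "c \<in> {..<K} \<times> {..<K}" "even (fst c + snd c)"
  shows "\<exists>w\<in>query_vertices K. in_square (query_point T u v w) (black_square T u' c)"
proof -
  obtain a b where ab: "c = (a, b)" by (cases c)
  consider "u < u'" | "u' < u" using assms by linarith
  then show ?thesis
  proof cases
    case 1
    \<comment> \<open>The copy lies up and to the right of the queried one, over the upper right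
      corner: one step \<open>4 * (T + 1)\<close> covers the margin \<open>2 * T + 2\<close> and the
      displacement \<open>2 * v\<close> of the point. The other case uses the lower left
      corner.\<close>
    with assms have "in_square (query_point T u v (a + 1, b + 1)) (black_square T u' c)"
      using grid_line_shift_bounds[of u u' T a] grid_line_shift_bounds[of u u' T b]
      by (simp add: ab grid_line_Suc abs_le_iff)
    moreover have "(a + 1, b + 1) \<in> query_vertices K" using c by (simp add: ab query_vertices_def)
    ultimately show ?thesis by blast
  next
    case 2
    with assms have "in_square (query_point T u v (a, b)) (black_square T u' c)"
      using grid_line_shift_bounds[of u' u T a] grid_line_shift_bounds[of u' u T b]
      by (simp add: ab abs_le_iff)
    moreover have "(a, b) \<in> query_vertices K" using c by (simp add: ab query_vertices_def)
    ultimately show ?thesis by blast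
  qed
qed

lemma white_pierced:
  assumes "1 \<le> T" "v \<noteq> v'" "0 \<le> v" "v \<le> T" "0 \<le> v'" "v' \<le> T"
    and c: "c \<in> {..<K} \<times> {..<K}" "odd (fst c + snd c)"
  shows "\<exists>w\<in>query_vertices K. in_square (query_point T u v w) (white_square T u v' c)"
proof -
  obtain a b where ab: "c = (a, b)" by (cases c)
  consider "v < v'" | "v' < v" using assms by linarith
  then show ?thesis
  proof cases
    case 1
    \<comment> \<open>A larger antidiagonal shift moves the square over its lower right corner, a
      smaller one over its upper left corner. The relative move is at least 2, the white
      margin.\<close>
    with assms have "in_square (query_point T u v (a + 1, b)) (white_square T u v' c)"
      using half_side_ge[OF \<open>1 \<le> T\<close>] by (simp add: ab grid_line_Suc abs_le_iff)
    moreover have "(a + 1, b) \<in> query_vertices K" using c by (simp add: ab query_vertices_def)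
    ultimately show ?thesis by blast
  next
    case 2
    with assms have "in_square (query_point T u v (a, b + 1)) (white_square T u v' c)"
      using half_side_ge[OF \<open>1 \<le> T\<close>] by (simp add: ab grid_line_Suc abs_le_iff)
    moreover have "(a, b + 1) \<in> query_vertices K" using c by (simp add: ab query_vertices_def)
    ultimately show ?thesis by blast
  qed
qed

lemma in_square_query: "in_square (query_point T u v w) (query_square T u v w)"
  by (cases w) simp

text \<open>Grid lines stay below \<open>half_side T * (2 * int K + 3)\<close>; two further half
  sides leave room for the centre of a cell and the antidiagonal shift.\<close>

definition board_bound :: "nat \<Rightarrow> int \<Rightarrow> int" where
  "board_bound K T = half_side T * (2 * int K + 5)"

lemma valid_board_squares:
  assumes "1 \<le> T" "0 \<le> u" "u \<le> T" "0 \<le> v" "v \<le> T"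
  shows "c \<in> {..<K} \<times> {..<K} \<Longrightarrow> valid_square (board_bound K T) (black_square T u c)"
    and "c \<in> {..<K} \<times> {..<K} \<Longrightarrow> valid_square (board_bound K T) (white_square T u v c)"
    and "w \<in> query_vertices K \<Longrightarrow> valid_square (board_bound K T) (query_square T u v w)"
proof -
  note bounds = half_side_ge[OF \<open>1 \<le> T\<close>] grid_line_bounds[OF \<open>0 \<le> u\<close> \<open>u \<le> T\<close>, of _ K] assms
  have bb: "board_bound K T = half_side T * (2 * int K + 3) + 2 * half_side T"
    by (simp add: board_bound_def algebra_simps)
  obtain a b where c: "c = (a, b)" by (cases c)
  obtain a' b' where w: "w = (a', b')" by (cases w)
  show "valid_square (board_bound K T) (black_square T u c)"
    "valid_square (board_bound K T) (white_square T u v c)" if "c \<in> {..<K} \<times> {..<K}"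
  proof -
    have "a \<le> K" "b \<le> K" using that by (auto simp: c)
    note facts = bounds(1) bounds(2,3)[OF this(1)] bounds(2,3)[OF this(2)] assms
    show "valid_square (board_bound K T) (black_square T u c)"
      "valid_square (board_bound K T) (white_square T u v c)"
      unfolding c valid_square.simps black_square.simps white_square.simps bb
      by (intro conjI; insert facts; linarith)+
  qed
  show "valid_square (board_bound K T) (query_square T u v w)" if "w \<in> query_vertices K"
  proof -
    have "a' \<le> K" "b' \<le> K" using that by (auto simp: w query_vertices_def)
    note facts = bounds(1) bounds(2,3)[OF this(1)] bounds(2,3)[OF this(2)] assms
    show ?thesis
      unfolding w valid_square.simps query_square.simps bb
      by (intro conjI; insert facts; linarith)
  qed
qed

section \<open>The reduction\<close>

declare black_square.simps [simp del] white_square.simps [simp del] query_square.simps [simp del]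
  squares_meet.simps [simp del]

text \<open>Both values of bit \<open>j\<close> select a copy, so that the length of the stream does not depend on the bits;
  the players query the copies \<open>2 * i + 1\<close> and \<open>2 * j + 1\<close>.\<close>

definition bit_shift :: "nat set \<Rightarrow> nat \<Rightarrow> int" where
  "bit_shift X j = 2 * int j + of_bool (j \<in> X)"

definition black_cells :: "nat \<Rightarrow> (nat \<times> nat) list" where
  "black_cells K = filter (\<lambda>c. even (fst c + snd c)) (List.product [0..<K] [0..<K])"

definition white_cells :: "nat \<Rightarrow> (nat \<times> nat) list" where
  "white_cells K = filter (\<lambda>c. odd (fst c + snd c)) (List.product [0..<K] [0..<K])"

definition first_part :: "nat \<Rightarrow> nat \<Rightarrow> nat set \<Rightarrow> square list" where
  "first_part K N X =
     concat (map (\<lambda>j. map (black_square (2 * int N) (bit_shift X j)) (black_cells K)) [0..<N])"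

definition second_part :: "nat \<Rightarrow> nat \<Rightarrow> nat \<Rightarrow> nat set \<Rightarrow> square list" where
  "second_part K N i Y =
     concat (map (\<lambda>j. map (white_square (2 * int N) (2 * int i + 1) (bit_shift Y j)) (white_cells K)) [0..<N])"

text \<open>The \<open>L\<close> extra entries pad the stream to a prescribed length. They repeat
  the square at the query vertex \<open>(0, 0)\<close>, so the set of squares is unchanged.\<close>

definition third_part :: "nat \<Rightarrow> nat \<Rightarrow> nat \<Rightarrow> nat \<Rightarrow> nat \<Rightarrow> square list" where
  "third_part K N L i j =
     map (query_square (2 * int N) (2 * int i + 1) (2 * int j + 1))
       (filter (\<lambda>c. even (fst c + snd c)) (List.product [0..<Suc K] [0..<Suc K]) @ replicate L (0, 0))"

lemma set_black_cells: "set (black_cells K) = {c \<in> {..<K} \<times> {..<K}. even (fst c + snd c)}"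
  by (auto simp: black_cells_def)

lemma set_white_cells: "set (white_cells K) = {c \<in> {..<K} \<times> {..<K}. odd (fst c + snd c)}"
  by (auto simp: white_cells_def)

lemma set_first_part:
  "set (first_part K N X) =
     (\<Union>j<N. black_square (2 * int N) (bit_shift X j) ` {c \<in> {..<K} \<times> {..<K}. even (fst c + snd c)})"
  by (simp add: first_part_def set_black_cells atLeast0LessThan)

lemma set_second_part:
  "set (second_part K N i Y) =
     (\<Union>j<N. white_square (2 * int N) (2 * int i + 1) (bit_shift Y j) `
        {c \<in> {..<K} \<times> {..<K}. odd (fst c + snd c)})"
  by (simp add: second_part_def set_white_cells atLeast0LessThan)

lemma set_filter_vertices:
  "set (filter (\<lambda>c. even (fst c + snd c)) (List.product [0..<Suc K] [0..<Suc K])) = query_vertices K"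
  by (auto simp: query_vertices_def less_Suc_eq_le simp del: upt_Suc)

lemma set_third_part:
  "set (third_part K N L i j) =
     query_square (2 * int N) (2 * int i + 1) (2 * int j + 1) ` query_vertices K"
proof -
  have "(0, 0) \<in> query_vertices K" by (simp add: query_vertices_def)
  then show ?thesis
    unfolding third_part_def set_map set_append set_filter_vertices by (auto simp: set_replicate_conv_if simp del: query_square.simps)
qed

lemma length_first_part: "length (first_part K N X) = N * length (black_cells K)"
  by (simp add: first_part_def length_concat o_def sum_list_triv)

lemma length_second_part: "length (second_part K N i Y) = N * length (white_cells K)"
  by (simp add: second_part_def length_concat o_def sum_list_triv)

lemma length_third_part: "length (third_part K N L i j) = card (query_vertices K) + L"
  unfolding set_filter_vertices[of K, symmetric] third_part_def
  by (subst distinct_card) (auto intro!: distinct_filter distinct_product simp del: upt_Suc)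

lemma length_cells: "length (black_cells K) + length (white_cells K) = K * K"
  unfolding black_cells_def white_cells_def by (subst sum_length_filter_compl) simp

definition chain_squares :: "nat \<Rightarrow> nat \<Rightarrow> nat \<Rightarrow> nat \<Rightarrow> nat \<Rightarrow> nat set \<Rightarrow> nat set \<Rightarrow> square list" where
  "chain_squares K N L i j X Y = first_part K N X @ second_part K N i Y @ third_part K N L i j"

lemma chain_squares_cases:
  assumes "b \<in> set (chain_squares K N L i j X Y)"
  obtains k c where "k < N" "c \<in> {..<K} \<times> {..<K}" "even (fst c + snd c)"
      "b = black_square (2 * int N) (bit_shift X k) c"
    | k c where "k < N" "c \<in> {..<K} \<times> {..<K}" "odd (fst c + snd c)"
      "b = white_square (2 * int N) (2 * int i + 1) (bit_shift Y k) c"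
    | w where "w \<in> query_vertices K" "b = query_square (2 * int N) (2 * int i + 1) (2 * int j + 1) w"
proof -
  consider "b \<in> set (first_part K N X)" | "b \<in> set (second_part K N i Y)" | "b \<in> set (third_part K N L i j)"
    using assms by (auto simp: chain_squares_def)
  then show ?thesis
  proof cases
    case 1
    then show ?thesis using that(1) unfolding set_first_part by (elim UN_E imageE CollectE conjE) simp
  next
    case 2
    then show ?thesis using that(2) unfolding set_second_part by (elim UN_E imageE CollectE conjE) simp
  next
    case 3
    then show ?thesis using that(3) unfolding set_third_part by (elim imageE)
  qed
qed

lemma bit_shift_bounds: "k < N \<Longrightarrow> 0 \<le> bit_shift X k \<and> bit_shift X k \<le> 2 * int N"
  by (auto simp: bit_shift_def)

lemma valid_chain_squares:
  assumes "i < N" "j < N" and b: "b \<in> set (chain_squares K N L i j X Y)"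
  shows "valid_square (board_bound K (2 * int N)) b"
proof -
  have T: "1 \<le> 2 * int N" "0 \<le> 2 * int i + 1" "2 * int i + 1 \<le> 2 * int N"
    "0 \<le> 2 * int j + 1" "2 * int j + 1 \<le> 2 * int N"
    using assms by auto
  from b show ?thesis
  proof (cases rule: chain_squares_cases)
    case (1 k c)
    then show ?thesis using valid_board_squares(1)[OF T(1) _ _ T(4,5)] bit_shift_bounds by blast
  next
    case (2 k c)
    then show ?thesis using valid_board_squares(2)[OF T(1-3)] bit_shift_bounds by blast
  next
    case (3 w)
    then show ?thesis using valid_board_squares(3)[OF T] by blast
  qed
qed

section \<open>The independence number when both queried bits are set or both are clear\<close>

lemma chain_alpha_ge:
  assumes p: "p \<in> {1, \<infinity>}" and ij: "i < N" "j < N" and "i \<in> X" "j \<in> Y"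
  shows "K * K + card (query_vertices K)
    \<le> stream_alpha p (map (square_ball p (board_bound K (2 * int N))) (chain_squares K N L i j X Y))"
proof -
  define T u v where "T = 2 * int N" and "u = 2 * int i + 1" and "v = 2 * int j + 1"
  have T: "1 \<le> T" "0 \<le> v" "v \<le> T" using ij by (auto simp: T_def v_def)
  \<comment> \<open>One square per cell, from the queried copy of its colour, and one per query
    vertex. The disjoint sum keeps cells and vertices with equal coordinates apart.\<close>
  define b where "b z = (case z of
       Inl c \<Rightarrow> (if even (fst c + snd c) then black_square T u c else white_square T u v c)
     | Inr w \<Rightarrow> query_square T u v w)" for z :: "(nat \<times> nat) + (nat \<times> nat)"
  let ?J = "({..<K} \<times> {..<K}) <+> query_vertices K"
  have "card ?J \<le> stream_alpha p (map (square_ball p (board_bound K (2 * int N))) (chain_squares K N L i j X Y))"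
  proof (rule card_le_stream_alpha_squares[OF p valid_chain_squares[OF ij]])
    show "finite ?J" by (simp add: finite_query_vertices)
    show "b z \<in> set (chain_squares K N L i j X Y)" if "z \<in> ?J" for z
    proof -
      have "bit_shift X i = u" "bit_shift Y j = v" using assms by (auto simp: bit_shift_def u_def v_def)
      then have "black_square T u c \<in> set (first_part K N X)"
        if "c \<in> {..<K} \<times> {..<K}" "even (fst c + snd c)" for c
        using ij that unfolding set_first_part T_def by blast
      moreover have "white_square T u v c \<in> set (second_part K N i Y)"
        if "c \<in> {..<K} \<times> {..<K}" "odd (fst c + snd c)" for c
        using ij that \<open>bit_shift Y j = v\<close> unfolding set_second_part T_def u_def by blast
      moreover have "query_square T u v w \<in> set (third_part K N L i j)" if "w \<in> query_vertices K" for w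
        using that unfolding set_third_part T_def u_def v_def by blast
      ultimately show ?thesis
        using \<open>z \<in> ?J\<close> unfolding chain_squares_def b_def by (auto split: sum.split)
    qed
    have even_w: "even (fst w + snd w)" if "w \<in> query_vertices K" for w
      using that by (auto simp: query_vertices_def)
    show "\<not> squares_meet (b z) (b z')" if "z \<in> ?J" "z' \<in> ?J" "z \<noteq> z'" for z z'
    proof (cases z; cases z')
      fix c c' assume z: "z = Inl c" "z' = Inl c'"
      then have "c \<noteq> c'" using that by simp
      then have "\<not> squares_meet (white_square T u v c) (black_square T u c')"
        using black_white_disjoint[OF T, of c' c u] squares_meet_commute by metis
      then show ?thesis
        using \<open>c \<noteq> c'\<close> black_black_disjoint[OF T(1)] white_white_disjoint[OF T(1)] black_white_disjoint[OF T]
        by (simp add: z b_def)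
    next
      fix c w assume z: "z = Inl c" "z' = Inr w"
      then show ?thesis
        using that black_query_disjoint[OF T] even_w white_query_disjoint[OF T(1)] by (auto simp: b_def)
    next
      fix c w assume z: "z = Inr w" "z' = Inl c"
      then show ?thesis
        using that black_query_disjoint[OF T] even_w white_query_disjoint[OF T(1)]
        unfolding squares_meet_commute[of "b z"] by (auto simp: b_def)
    next
      fix w w' assume z: "z = Inr w" "z' = Inr w'"
      then show ?thesis
        using that query_query_disjoint[OF T(1), of w w' u v] by (simp add: b_def)
    qed
  qed
  then show ?thesis by (simp add: card_Plus finite_query_vertices card_cartesian_product)
qed

lemma chain_alpha_le:
  assumes p: "p \<in> {1, \<infinity>}" and ij: "i < N" "j < N" and "i \<notin> X" "j \<notin> Y"
  shows "stream_alpha p (map (square_ball p (board_bound K (2 * int N))) (chain_squares K N L i j X Y))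
    \<le> card (query_vertices K)"
proof (rule stream_alpha_squares_le_card[OF p valid_chain_squares[OF ij] finite_query_vertices])
  define T u v where "T = 2 * int N" and "u = 2 * int i + 1" and "v = 2 * int j + 1"
  have T: "1 \<le> T" "0 \<le> v" "v \<le> T" "0 \<le> u" "u \<le> T" using ij by (auto simp: T_def u_def v_def)
  note shift = bit_shift_bounds[of _ N, folded T_def]
  \<comment> \<open>The odd shift \<open>2 * i + 1\<close> arises only from \<open>k = i\<close>
    with the bit set, and likewise for \<open>j\<close>.\<close>
  have uv: "u \<noteq> bit_shift X k" "v \<noteq> bit_shift Y k" for k
    using assms by (auto simp: bit_shift_def u_def v_def) presburger+
  show "\<exists>w\<in>query_vertices K. in_square (query_point T u v w) b" if "b \<in> set (chain_squares K N L i j X Y)" for b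
    using that
  proof (cases rule: chain_squares_cases)
    case (1 k c)
    then show ?thesis
      using black_pierced[OF uv(1) T(4,5) _ _ T(2,3) 1(2,3), of k] shift[OF 1(1), of X]
      by (simp add: T_def)
  next
    case (2 k c)
    then show ?thesis
      using white_pierced[OF T(1) uv(2) T(2,3) _ _ 2(2,3), of k] shift[OF 2(1), of Y]
      by (simp add: T_def u_def)
  next
    case (3 w)
    then show ?thesis using in_square_query[of T u v w] by (auto simp: T_def u_def v_def)
  qed
qed

section \<open>Choice of parameters and the asymptotic bound\<close>

lemma board_size_exists:
  fixes \<epsilon> :: real
  assumes "0 < \<epsilon>"
  obtains K :: nat where "(3 - \<epsilon>) * card (query_vertices K) < real (K * K + card (query_vertices K))"
proof -
  \<comment> \<open>Capping at 1 keeps \<open>2 - \<eta>\<close> positive, so that the upper bound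
    on the number of vertices can be multiplied by it.\<close>
  define \<eta> where "\<eta> = min \<epsilon> 1"
  have \<eta>: "0 < \<eta>" "\<eta> \<le> 1" "\<eta> \<le> \<epsilon>" using assms by (auto simp: \<eta>_def)
  \<comment> \<open>Expanding \<open>(K + 1) * (K + 2)\<close> leaves a surplus
    \<open>3 * K + 2\<close>; \<open>K * \<eta> \<ge> 6\<close> pays \<open>3 * K\<close> from the
    term \<open>\<eta> * K^2 / 2\<close> and the constant from
    \<open>3 * \<eta> * K / 2\<close>.\<close>
  obtain K :: nat where "6 / \<eta> \<le> K" using real_arch_simple by blast
  then have K: "6 \<le> K * \<eta>" using \<eta> by (simp add: field_simps)
  define q where "q = real (card (query_vertices K))"
  have "real (2 * card (query_vertices K)) \<le> real ((K + 1) * (K + 2))"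
    using card_query_vertices_le[of K] by (simp only: of_nat_le_iff)
  then have q: "2 * q \<le> (real K + 1) * (real K + 2)" "0 \<le> q"
    by (auto simp: q_def algebra_simps)
  have "(2 - \<epsilon>) * q \<le> (2 - \<eta>) * q" using \<eta> q by (intro mult_right_mono) auto
  also have "\<dots> \<le> (2 - \<eta>) * ((real K + 1) * (real K + 2) / 2)"
    using \<eta> q by (intro mult_left_mono) auto
  also have "\<dots> < real K * real K"
  proof -
    have "6 * real K \<le> (K * \<eta>) * K" using K by (intro mult_right_mono) auto
    then show ?thesis using K \<eta> by (simp add: algebra_simps)
  qed
  finally have "(3 - \<epsilon>) * q < real K * real K + q" by (simp add: algebra_simps)
  then show ?thesis using that by (simp add: q_def)
qed

text \<open>Coordinates are at most quadratic in \<open>n\<close> times a factor depending on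
  \<open>K\<close>; a third power of \<open>n\<close> absorbs that factor. The constant 36 is
  \<open>4 * 3^2\<close>, from \<open>2 * N + 1 \<le> 3 * n\<close>.\<close>

lemma chain_streams_fit:
  assumes "36 * (2 * K + 5) \<le> n" "N \<le> n" "3 \<le> e" "1 \<le> n"
  shows "2 * board_bound K (2 * int N) \<le> int (n ^ e)"
proof -
  have "2 * int N + 1 \<le> 3 * int n" using assms by linarith
  then have "(2 * int N + 1)\<^sup>2 \<le> (3 * int n)\<^sup>2" by (intro power_mono) auto
  then have "4 * (2 * int N + 1)\<^sup>2 * (2 * int K + 5) \<le> 36 * (int n)\<^sup>2 * (2 * int K + 5)"
    by (intro mult_right_mono) (auto simp: power_mult_distrib)
  also have "\<dots> = (int n)\<^sup>2 * int (36 * (2 * K + 5))" by simp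
  also have "\<dots> \<le> (int n)\<^sup>2 * int n"
    using assms(1) by (intro mult_left_mono) (simp_all only: of_nat_le_iff zero_le_power2)
  also have "\<dots> = int n ^ 3" by (simp add: power2_eq_square power3_eq_cube)
  also have "\<dots> \<le> int n ^ e" using assms by (intro power_increasing) auto
  finally show ?thesis by (simp add: board_bound_def half_side_def)
qed

lemma space_lower_bound:
  fixes A :: "2 ball_desc rand_alg" and \<epsilon> \<delta> :: real
  assumes p: "p \<in> {1, \<infinity>}" and "0 < \<epsilon>" "\<epsilon> < 3" "1 / 2 < \<delta>"
    and gap: "(3 - \<epsilon>) * card (query_vertices K) < real (K * K + card (query_vertices K))"
    and approx: "approximates_alpha p (3 - \<epsilon>) \<delta> A (ball_streams (n ^ e) n)"
    and space: "uses_space A (ball_streams (n ^ e) n) s"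
    and n: "36 * (2 * K + 5) \<le> n" "K * K + card (query_vertices K) \<le> n" and e: "3 \<le> e"
  shows "((2 * \<delta> - 1) / 8)\<^sup>2 * real (n div (K * K + card (query_vertices K))) \<le> real s + 1"
proof -
  define q where "q = card (query_vertices K)"
  define N where "N = n div (K * K + q)"
  define L where "L = n - (N * (K * K) + q)"
  define F where "F = map (square_ball p (board_bound K (2 * int N)))"
  have "(0, 0) \<in> query_vertices K" by (simp add: query_vertices_def)
  then have "0 < q" unfolding q_def using finite_query_vertices card_gt_0_iff by blast
  then have N: "0 < N" using n(2) by (simp add: N_def q_def div_greater_zero_iff)
  \<comment> \<open>Dividing by \<open>K * K + q\<close> reserves \<open>q\<close> places for every
    bit; as \<open>N > 0\<close>, this covers the single set of \<open>q\<close> query squares, and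
    \<open>L\<close> fills the rest.\<close>
  have "N * (K * K) + 1 * q \<le> N * (K * K) + N * q" using N by (intro add_mono mult_right_mono) auto
  also have "\<dots> \<le> n" unfolding N_def by (metis distrib_left div_times_less_eq_dividend)
  finally have len: "N * (K * K) + q + L = n" by (simp add: L_def)
  have "N \<le> n" by (simp add: N_def)
  then have fit: "2 * board_bound K (2 * int N) \<le> int (n ^ e)"
    using n e by (intro chain_streams_fit) auto
  have chain: "F (first_part K N X) @ F (second_part K N i Y) @ F (third_part K N L i j)
      = F (chain_squares K N L i j X Y)" for X Y i j
    by (simp add: F_def chain_squares_def)
  have streams: "F (chain_squares K N L i j X Y) \<in> ball_streams (n ^ e) n" if "i < N" "j < N" for X Y i j
    unfolding F_def
  proof (rule square_balls_in_ball_streams[OF p valid_chain_squares[OF that] fit])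
    have "length (chain_squares K N L i j X Y)
        = N * (length (black_cells K) + length (white_cells K)) + q + L"
      by (simp add: chain_squares_def length_first_part length_second_part length_third_part q_def distrib_left)
    then show "length (chain_squares K N L i j X Y) = n" using len by (simp add: length_cells)
  qed
  let ?P = "\<lambda>X Y i j D. is_approximation (3 - \<epsilon>) (real (stream_alpha p (F (chain_squares K N L i j X Y))))
        (answer D (memory_after D (F (chain_squares K N L i j X Y))))"
  have prob: "\<delta> \<le> measure_pmf.prob A {D. ?P X Y i j D}" if "i < N" "j < N" for X Y i j
    using approx streams[OF that] unfolding approximates_alpha_def by blast
  have "((2 * \<delta> - 1) / 8)\<^sup>2 * real N \<le> real s + 1"
  \<comment> \<open>The threshold \<open>q\<close> separates the cases: an approximation is at least
    \<open>1 / (3 - \<epsilon>)\<close> times the independence number, which exceeds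
    \<open>q\<close> if both bits are set by \<open>gap\<close>, and at most the independence
    number, hence at most \<open>q\<close>, if both are clear.\<close>
  proof (rule chained_index_space[where out = "\<lambda>a. real q < a"
        and ?P1.0 = "\<lambda>X. F (first_part K N X)" and ?P2.0 = "\<lambda>i Y. F (second_part K N i Y)"
        and ?P3.0 = "\<lambda>i j. F (third_part K N L i j)", OF N _ _ _ space _ _ \<open>1 / 2 < \<delta>\<close>])
    show "length (F (first_part K N X)) = N * length (black_cells K)" for X
      by (simp add: F_def length_first_part)
    show "length (F (second_part K N i Y)) = N * length (white_cells K)" for i Y
      by (simp add: F_def length_second_part)
    show "F (first_part K N X) @ F (second_part K N i Y) @ F (third_part K N L i j) \<in> ball_streams (n ^ e) n"
      if "i \<in> {..<N}" "j \<in> {..<N}" for X Y i j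
      unfolding chain using streams that by simp
    show "\<delta> \<le> measure_pmf.prob A {D. real q < answer D (memory_after D
        (F (first_part K N X) @ F (second_part K N i Y) @ F (third_part K N L i j)))}"
      if "X \<subseteq> {..<N}" "Y \<subseteq> {..<N}" "i \<in> X" "j \<in> Y" for X Y i j
    proof -
      have ij: "i < N" "j < N" using that by auto
      have "real q < answer D (memory_after D (F (chain_squares K N L i j X Y)))" if "?P X Y i j D" for D
      proof -
        have "(3 - \<epsilon>) * q < real (stream_alpha p (F (chain_squares K N L i j X Y)))"
          using gap chain_alpha_ge[OF p ij \<open>i \<in> X\<close> \<open>j \<in> Y\<close>, of K L] unfolding q_def F_def by linarith
        moreover have "real (stream_alpha p (F (chain_squares K N L i j X Y)))
            \<le> (3 - \<epsilon>) * answer D (memory_after D (F (chain_squares K N L i j X Y)))"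
          using that \<open>\<epsilon> < 3\<close> by (simp add: is_approximation_def field_simps)
        ultimately have "(3 - \<epsilon>) * q < (3 - \<epsilon>) * answer D (memory_after D (F (chain_squares K N L i j X Y)))"
          by linarith
        then show ?thesis using \<open>\<epsilon> < 3\<close> by simp
      qed
      then have "measure_pmf.prob A {D. ?P X Y i j D} \<le> measure_pmf.prob A
          {D. real q < answer D (memory_after D (F (chain_squares K N L i j X Y)))}"
        by (intro measure_pmf.finite_measure_mono) auto
      then show ?thesis unfolding chain using prob[OF ij, of X Y] by linarith
    qed
    show "\<delta> \<le> measure_pmf.prob A {D. \<not> real q < answer D (memory_after D
        (F (first_part K N X) @ F (second_part K N i Y) @ F (third_part K N L i j)))}"
      if "i \<in> {..<N} - X" "j \<in> {..<N} - Y" for X Y i j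
    proof -
      have ij: "i < N" "j < N" "i \<notin> X" "j \<notin> Y" using that by auto
      have "\<not> real q < answer D (memory_after D (F (chain_squares K N L i j X Y)))" if "?P X Y i j D" for D
      proof -
        have "real (stream_alpha p (F (chain_squares K N L i j X Y))) \<le> real q"
          using chain_alpha_le[OF p ij, of K L] unfolding q_def F_def by simp
        then show ?thesis using that by (simp add: is_approximation_def)
      qed
      then have "measure_pmf.prob A {D. ?P X Y i j D} \<le> measure_pmf.prob A
          {D. \<not> real q < answer D (memory_after D (F (chain_squares K N L i j X Y)))}"
        by (intro measure_pmf.finite_measure_mono) auto
      then show ?thesis unfolding chain using prob[OF ij(1,2), of X Y] by linarith
    qed
  qed
  then show ?thesis by (simp add: N_def q_def)
qed

theorem theorem14:
  fixes p :: ereal and \<epsilon> \<delta> :: real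
  assumes "p \<in> {1, \<infinity>}" and "0 < \<epsilon>" and "\<epsilon> < 3" and "1 / 2 < \<delta>"
  shows "\<exists>e0::nat. \<forall>e \<ge> e0.
    \<forall>(A :: nat \<Rightarrow> 2 ball_desc rand_alg) (S :: nat \<Rightarrow> nat).
      (\<forall>\<^sub>F n in sequentially.
         approximates_alpha p (3 - \<epsilon>) \<delta> (A n) (ball_streams (n ^ e) n) \<and>
         uses_space (A n) (ball_streams (n ^ e) n) (S n)) \<longrightarrow>
      (\<lambda>n. real (S n)) \<in> \<Omega>(\<lambda>n. real n)"
proof (intro exI[of _ 3] allI impI)
  fix e :: nat and A :: "nat \<Rightarrow> 2 ball_desc rand_alg" and S :: "nat \<Rightarrow> nat"
  assume e: "3 \<le> e"
    and alg: "\<forall>\<^sub>F n in sequentially.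
         approximates_alpha p (3 - \<epsilon>) \<delta> (A n) (ball_streams (n ^ e) n) \<and>
         uses_space (A n) (ball_streams (n ^ e) n) (S n)"
  obtain K where K: "(3 - \<epsilon>) * card (query_vertices K) < real (K * K + card (query_vertices K))"
    using board_size_exists[OF \<open>0 < \<epsilon>\<close>] .
  define C where "C = K * K + card (query_vertices K)"
  define c where "c = ((2 * \<delta> - 1) / 8)\<^sup>2"
  have "0 < c" using assms by (simp add: c_def)
  have "(0, 0) \<in> query_vertices K" by (simp add: query_vertices_def)
  then have "0 < C" unfolding C_def using finite_query_vertices card_gt_0_iff by (metis add_gr_0 empty_iff)
  \<comment> \<open>Beyond \<open>m\<close> the summand 1 in \<open>S n + 1\<close> costs at most
    half of the bound \<open>c / (2 * C) * n\<close>.\<close>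
  obtain m :: nat where m: "4 * real C / c \<le> m" using real_arch_simple by blast
  show "(\<lambda>n. real (S n)) \<in> \<Omega>(\<lambda>n. real n)"
  proof (rule landau_omega.bigI)
    show "0 < c / (4 * real C)" using \<open>0 < c\<close> \<open>0 < C\<close> by simp
    show "\<forall>\<^sub>F n in sequentially. c / (4 * real C) * norm (real n) \<le> norm (real (S n))"
      using alg eventually_ge_at_top[of "36 * (2 * K + 5)"] eventually_ge_at_top[of C] eventually_ge_at_top[of m]
    proof eventually_elim
      case (elim n)
      have "c * real (n div C) \<le> real (S n) + 1"
        unfolding c_def C_def using elim assms K e
        by (intro space_lower_bound[where p = p and \<epsilon> = \<epsilon> and n = n and A = "A n" and e = e]) (auto simp: C_def)
      \<comment> \<open>For \<open>n \<ge> C\<close> rounding down loses at most a factor 2.\<close>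
      moreover have "real n \<le> 2 * real C * real (n div C)"
      proof -
        have "1 \<le> n div C" using elim \<open>0 < C\<close> by (simp add: Suc_le_eq div_greater_zero_iff)
        then have "C * 1 \<le> C * (n div C)" by (rule mult_le_mono2)
        moreover have "n < C + C * (n div C)"
          using mod_less_divisor[OF \<open>0 < C\<close>, of n] mult_div_mod_eq[of C n] by linarith
        ultimately have "n \<le> 2 * C * (n div C)" unfolding mult.assoc by linarith
        then show ?thesis by (metis of_nat_le_iff of_nat_mult of_nat_numeral)
      qed
      then have "c / (2 * real C) * real n \<le> c * real (n div C)"
        using \<open>0 < c\<close> \<open>0 < C\<close> by (simp add: field_simps)
      moreover have "1 \<le> c / (4 * real C) * real n"
      proof -
        have "4 * real C / c \<le> real n" using m elim by linarith
        then show ?thesis using \<open>0 < c\<close> \<open>0 < C\<close> by (simp add: field_simps)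
      qed
      moreover have "c / (2 * real C) * real n = 2 * (c / (4 * real C) * real n)" by (simp add: field_simps)
      ultimately have "c / (4 * real C) * real n \<le> real (S n)" by linarith
      then show ?case by simp
    qed
  qed
qed

end
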